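(* Consider two Ornstein-Uhlenbeck processes with the same mean-reversion speed $\alpha\in\mathbb R$, driven by two independent Riemann-Liouville processes with $\frac12<H_1<H_2$, and let $0<T_1<T_2$. Then, for every $0\le s<T_1$, $$\begin{vmatrix} c_{H_1}\int_s^{T_1}e^{\alpha(T_1-u)}(u-s)^{H_1-\frac32}du & c_{H_2}\int_s^{T_1}e^{\alpha(T_1-u)}(u-s)^{H_2-\frac32}du\\[4pt] c_{H_1}\int_s^{T_2}e^{\alpha(T_2-u)}(u-s)^{H_1-\frac32}du & c_{H_2}\int_s^{T_2}e^{\alpha(T_2-u)}(u-s)^{H_2-\frac32}du \end{vmatrix}\neq0,$$ where $c_H:=\frac1{\Gamma(H+\frac12)}$.
   Context: The Riemann-Liouville process with exponent $H$ is $U^H_t=\frac1{\Gamma(H+\frac12)}\int_0^t(t-s)^{H-\frac12}dW_s$ with $W$ a standard one-dimensional Brownian motion. For $H>\frac12$ the Ornstein-Uhlenbeck process $Y_t=\alpha\int_0^tY_s\,ds+U^H_t$ is a Gaussian Volterra process $Y_t=\int_0^tK_Y(t,s)\,dW_s$ with kernel $K_Y(t,s)=\frac1{\Gamma(H+\frac12)}\int_s^te^{\alpha(t-u)}\left(H-\frac12\right)(u-s)^{H-\frac32}du$; the entries of the determinant are these kernels evaluated at $(T_j,s)$, up to the constant factors $H_i-\frac12>0$. *)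

theory Defs
  imports "HOL-Analysis.Analysis"
begin

text \<open>
  The normalising constant of the Riemann-Liouville process with exponent \<open>H\<close>,
  \<open>U\<^sub>t = rl_const H * \<integral>\<^sub>0\<^sup>t (t - r) powr (H - 1/2) dW\<^sub>r\<close>.
  The Ornstein-Uhlenbeck process with speed \<open>\<alpha>\<close> driven by it has the Volterra kernel
  \<open>rl_const H * \<integral>\<^sub>s\<^sup>t exp (\<alpha> * (t - u)) * (H - 1/2) * (u - s) powr (H - 3/2) du\<close>.
\<close>

definition rl_const :: "real \<Rightarrow> real"
  where "rl_const H = 1 / Gamma (H + 1/2)"

end

theory Submission
  imports Defs
begin

text \<open>
  The kernel for \<open>H2\<close> is the kernel for \<open>H1\<close> times the strictly increasing weight
  \<open>(u - s) powr (H2 - H1)\<close>. Comparing this weight with its value at \<open>T1\<close> on either side of \<open>T1\<close>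
  shows that the ratio of the \<open>H2\<close>-integral to the \<open>H1\<close>-integral is strictly larger over
  \<open>[s, T2]\<close> than over \<open>[s, T1]\<close>. The factor \<open>exp (\<alpha> * T)\<close> is common to each row and drops out.
\<close>

text \<open>Splitting both long integrals at \<open>b\<close>, the product of the two integrals over
  \<open>{a..b}\<close> cancels, and the constant \<open>k\<close> separates the remaining cross
  terms. Strictness comes from the right part, where \<open>f\<close> and \<open>g\<close> are
  continuous; on the left they may be singular at \<open>a\<close>.\<close>

lemma integral_ratio_less:
  fixes f g :: "real \<Rightarrow> real"
  assumes ab: "a \<le> b" and bc: "b < c"
    and f: "f integrable_on {a..c}" and g: "g integrable_on {a..c}"
    and cf: "continuous_on {b..c} f" and cg: "continuous_on {b..c} g"
    and f_nonneg: "\<And>u. u \<in> {b..c} \<Longrightarrow> 0 \<le> f u"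
    and f_pos: "0 < integral {a..b} f"
    and le: "\<And>u. u \<in> {a..b} \<Longrightarrow> g u \<le> k * f u"
    and less: "\<And>u. u \<in> {b<..<c} \<Longrightarrow> k * f u < g u"
  shows "integral {a..b} g * integral {a..c} f < integral {a..b} f * integral {a..c} g"
proof -
  have fab: "f integrable_on {a..b}" and gab: "g integrable_on {a..b}"
    using bc by (auto intro: integrable_on_subinterval[OF f] integrable_on_subinterval[OF g])
  have fsplit: "integral {a..c} f = integral {a..b} f + integral {b..c} f"
    and gsplit: "integral {a..c} g = integral {a..b} g + integral {b..c} g"
    using ab bc f g by (simp_all add: Henstock_Kurzweil_Integration.integral_combine)
  have "integral {a..b} g \<le> integral {a..b} (\<lambda>u. k * f u)"
    using integrable_on_cmult_left[OF fab, of k] by (intro integral_le gab le) auto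
  then have left: "integral {a..b} g \<le> k * integral {a..b} f" by simp
  have "integral {b..c} (\<lambda>u. k * f u) < integral {b..c} g"
    using bc by (intro integral_less_real continuous_intros cf cg less) auto
  then have right: "k * integral {b..c} f < integral {b..c} g" by simp
  have "0 \<le> integral {b..c} f"
    by (intro integral_nonneg integrable_continuous_interval cf f_nonneg)
  then have "integral {a..b} g * integral {b..c} f \<le> k * integral {a..b} f * integral {b..c} f"
    using left by (rule mult_right_mono[rotated])
  also have "\<dots> = integral {a..b} f * (k * integral {b..c} f)" by simp
  also have "\<dots> < integral {a..b} f * integral {b..c} g"
    using right f_pos by (rule mult_strict_left_mono)
  finally show ?thesis
    unfolding fsplit gsplit by (simp add: algebra_simps)
qed

text \<open>For negative \<open>p\<close> the power blows up at \<open>s\<close>, so continuity does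
  not suffice. Being nonnegative and integrable, it is absolutely integrable, which survives
  multiplication by the bounded exponential.\<close>

lemma integrable_exp_mult_powr:
  fixes \<beta> p s t :: real
  assumes p: "-1 < p" and st: "s \<le> t"
  shows "(\<lambda>u. exp (\<beta> * u) * (u - s) powr p) integrable_on {s..t}"
proof -
  have "(\<lambda>u. u powr p) integrable_on {0..t - s}"
    using p st by (intro integrable_on_powr_from_0) auto
  from integrable_shift_real_ivl[OF this, of "-s"]
  have "(\<lambda>u. (u - s) powr p) absolutely_integrable_on {s..t}"
    by (intro nonnegative_absolutely_integrable_1) auto
  moreover have cont: "continuous_on {s..t} (\<lambda>u. exp (\<beta> * u))"
    by (intro continuous_intros)
  moreover have "bounded ((\<lambda>u. exp (\<beta> * u)) ` {s..t})"
    using cont by (intro compact_imp_bounded compact_continuous_image) auto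
  ultimately have "(\<lambda>u. exp (\<beta> * u) * (u - s) powr p) absolutely_integrable_on {s..t}"
    by (intro absolutely_integrable_bounded_measurable_product_real
        continuous_imp_measurable_on_sets_lebesgue) auto
  then show ?thesis
    by (rule absolutely_integrable_on_def[THEN iffD1, THEN conjunct1])
qed

lemma integral_exp_mult_powr_pos:
  fixes \<beta> p s t :: real
  assumes p: "-1 < p" and st: "s < t"
  shows "0 < integral {s..t} (\<lambda>u. exp (\<beta> * u) * (u - s) powr p)"
proof -
  let ?f = "\<lambda>u. exp (\<beta> * u) * (u - s) powr p"
  define m where "m = (s + t) / 2"
  have m: "s < m" "m < t" using st by (auto simp: m_def)
  have cont: "continuous_on {m..t} ?f"
    using m by (intro continuous_intros) auto
  \<comment> \<open>Strict positivity is obtained away from the possible singularity at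
    \<open>s\<close>; the rest of the interval contributes a nonnegative amount.\<close>
  have "integral {m..t} (\<lambda>u. 0) < integral {m..t} ?f"
    using m by (intro integral_less_real cont continuous_intros) auto
  also have "\<dots> \<le> integral {s..t} ?f"
    using m p by (intro integral_subset_le integrable_continuous_interval cont
        integrable_exp_mult_powr) auto
  finally show ?thesis by simp
qed

theorem proposition18:
  fixes \<alpha> H1 H2 T1 T2 s :: real
  assumes "1/2 < H1" and "H1 < H2"
    and "0 < T1" and "T1 < T2"
    and "0 \<le> s" and "s < T1"
  shows "det (vector
     [vector [rl_const H1 * integral {s..T1} (\<lambda>u. exp (\<alpha> * (T1 - u)) * (u - s) powr (H1 - 3/2)),
              rl_const H2 * integral {s..T1} (\<lambda>u. exp (\<alpha> * (T1 - u)) * (u - s) powr (H2 - 3/2))],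
      vector [rl_const H1 * integral {s..T2} (\<lambda>u. exp (\<alpha> * (T2 - u)) * (u - s) powr (H1 - 3/2)),
              rl_const H2 * integral {s..T2} (\<lambda>u. exp (\<alpha> * (T2 - u)) * (u - s) powr (H2 - 3/2))]]
     :: real ^ 2 ^ 2) \<noteq> 0"
proof -
  \<comment> \<open>Without the factor \<open>exp (\<alpha> * T)\<close> the integrand is the same
    for \<open>T1\<close> and \<open>T2\<close>, so the integrals can be split at
    \<open>T1\<close>.\<close>
  define F where "F H = (\<lambda>u. exp (- \<alpha> * u) * (u - s) powr (H - 3/2))" for H
  have kernel: "integral {s..T} (\<lambda>u. exp (\<alpha> * (T - u)) * (u - s) powr (H - 3/2))
      = exp (\<alpha> * T) * integral {s..T} (F H)" for T H
  proof -
    have "(\<lambda>u. exp (\<alpha> * (T - u)) * (u - s) powr (H - 3/2)) = (\<lambda>u. exp (\<alpha> * T) * F H u)"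
      by (simp add: F_def fun_eq_iff algebra_simps flip: exp_add mult.assoc)
    then show ?thesis by simp
  qed
  let ?k = "(T1 - s) powr (H2 - H1)"
  \<comment> \<open>This includes \<open>u = s\<close>, where both sides are 0 because
    \<open>0 powr x = 0\<close>.\<close>
  have weight: "F H2 u = (u - s) powr (H2 - H1) * F H1 u" for u
    by (simp add: F_def flip: powr_add)
  have cont: "continuous_on {T1..T2} (F H)" for H
    unfolding F_def using assms by (intro continuous_intros) auto
  have "integral {s..T1} (F H2) * integral {s..T2} (F H1)
      < integral {s..T1} (F H1) * integral {s..T2} (F H2)"
  proof (rule integral_ratio_less[where k = ?k])
    show "F H1 integrable_on {s..T2}" "F H2 integrable_on {s..T2}"
      unfolding F_def using assms by (intro integrable_exp_mult_powr; simp)+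
    show "0 < integral {s..T1} (F H1)"
      unfolding F_def using assms by (intro integral_exp_mult_powr_pos) auto
    show "F H2 u \<le> ?k * F H1 u" if "u \<in> {s..T1}" for u
      unfolding weight using that assms
      by (intro mult_right_mono powr_mono2) (auto simp: F_def)
    \<comment> \<open>Here \<open>F H1 u\<close> is positive since \<open>u > T1 > s\<close>, so the
      strict growth of the weight carries over.\<close>
    show "?k * F H1 u < F H2 u" if "u \<in> {T1<..<T2}" for u
      unfolding weight using that assms
      by (intro mult_strict_right_mono powr_less_mono2) (auto simp: F_def)
  qed (use assms cont in \<open>auto simp: F_def\<close>)
  moreover have "rl_const H1 > 0" "rl_const H2 > 0"
    using assms by (auto simp: rl_const_def intro!: Gamma_real_pos)
  \<comment> \<open>This is the determinant with one exponential taken out of each row and one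
    \<open>rl_const\<close> out of each column.\<close>
  ultimately have "rl_const H1 * rl_const H2 * exp (\<alpha> * T1) * exp (\<alpha> * T2) *
      (integral {s..T1} (F H1) * integral {s..T2} (F H2)
        - integral {s..T1} (F H2) * integral {s..T2} (F H1)) \<noteq> 0"
    by simp
  then show ?thesis
    unfolding det_2 vector_2 kernel by (simp add: algebra_simps)
qed

end
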